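(* Let $X$ be a Zariski space, and let $f\colon X\to X$ be continuous. Then the $f$-ergodic Borel probability measures on $X$ are exactly the measures of the form \[\mu=\frac1r(\delta_{x_1}+\delta_{x_2}+\cdots+\delta_{x_r}),\] where the points $x_1,\dots,x_r\in X$ form a periodic cycle for $f$.
   Context: A topological space $X$ is Noetherian if every descending chain of closed subsets is eventually constant. A closed set $E\subseteq X$ is irreducible if it is not a union of two proper closed subsets. A Noetherian space $X$ is a Zariski space if every nonempty irreducible closed subset $E\subseteq X$ has a unique generic point, i.e. a unique point $x\in E$ with $\overline{\{x\}}=E$. $\delta_x$ is the Dirac probability measure at $x$. A periodic cycle is a finite set of distinct points cyclically permuted by $f$. A Borel probability measure is $f$-ergodic if it is $f$-invariant and ergodic in the usual sense (equivalently, extremal in the convex set of $f$-invariant probability measures). *)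

theory Defs
  imports "HOL-Probability.Probability"
begin

definition Noetherian_space :: "'a topology \<Rightarrow> bool" where
  "Noetherian_space X \<longleftrightarrow>
     (\<forall>C :: nat \<Rightarrow> 'a set. (\<forall>n. closedin X (C n)) \<and> decseq C \<longrightarrow> (\<exists>N. \<forall>n\<ge>N. C n = C N))"

(* The empty set satisfies this predicate; non-emptiness is required separately where needed. *)
definition irreducible_closedin :: "'a topology \<Rightarrow> 'a set \<Rightarrow> bool" where
  "irreducible_closedin X E \<longleftrightarrow>
     closedin X E \<and>
     \<not> (\<exists>A B. closedin X A \<and> closedin X B \<and> A \<subset> E \<and> B \<subset> E \<and> E = A \<union> B)"

definition Zariski_space :: "'a topology \<Rightarrow> bool" where
  "Zariski_space X \<longleftrightarrow>
     Noetherian_space X \<and>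
     (\<forall>E. irreducible_closedin X E \<and> E \<noteq> {} \<longrightarrow> (\<exists>!x. x \<in> E \<and> X closure_of {x} = E))"

(* Counterpart of the library constant borel for a topology with an explicit carrier.
   Used as a measure space it carries the zero measure; only its space and sets matter. *)
definition borel_of :: "'a topology \<Rightarrow> 'a measure" where
  "borel_of X = sigma (topspace X) {U. openin X U}"

lemma space_borel_of [simp]: "space (borel_of X) = topspace X"
  and sets_borel_of: "sets (borel_of X) = sigma_sets (topspace X) {U. openin X U}"
proof -
  have "{U. openin X U} \<subseteq> Pow (topspace X)"
    by (auto dest: openin_subset)
  then show "space (borel_of X) = topspace X"
    and "sets (borel_of X) = sigma_sets (topspace X) {U. openin X U}"
    by (simp_all add: borel_of_def)
qed

definition Borel_prob_measure :: "'a topology \<Rightarrow> 'a measure \<Rightarrow> bool" where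
  "Borel_prob_measure X M \<longleftrightarrow> sets M = sets (borel_of X) \<and> prob_space M"

definition invariant_measure :: "('a \<Rightarrow> 'a) \<Rightarrow> 'a measure \<Rightarrow> bool" where
  "invariant_measure f M \<longleftrightarrow> f \<in> measurable M M \<and> distr M M f = M"

definition ergodic_Borel_prob_measure :: "'a topology \<Rightarrow> ('a \<Rightarrow> 'a) \<Rightarrow> 'a measure \<Rightarrow> bool" where
  "ergodic_Borel_prob_measure X f M \<longleftrightarrow>
     Borel_prob_measure X M \<and> invariant_measure f M \<and>
     (\<forall>A\<in>sets M. f -` A \<inter> space M = A \<longrightarrow> measure M A = 0 \<or> measure M A = 1)"

definition periodic_cycle :: "'a topology \<Rightarrow> ('a \<Rightarrow> 'a) \<Rightarrow> 'a list \<Rightarrow> bool" where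
  "periodic_cycle X f xs \<longleftrightarrow>
     xs \<noteq> [] \<and> distinct xs \<and> set xs \<subseteq> topspace X \<and>
     (\<forall>i<length xs. f (xs ! i) = xs ! (Suc i mod length xs))"

(* (1/r) (dirac x_1 + ... + dirac x_r) for xs = [x_1, ..., x_r], where return (borel_of X) x
   is the Dirac measure at x. The library has no sum of measures, so the measure is given by
   its values on Borel sets; lemma emeasure_average_Dirac shows that these are attained. *)
definition average_Dirac :: "'a topology \<Rightarrow> 'a list \<Rightarrow> 'a measure" where
  "average_Dirac X xs =
     measure_of (topspace X) (sets (borel_of X))
       (\<lambda>A. (\<Sum>i<length xs. emeasure (return (borel_of X) (xs ! i)) A) / of_nat (length xs))"

lemma sets_average_Dirac [simp]: "sets (average_Dirac X xs) = sets (borel_of X)"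
  using sets.sigma_sets_eq[of "borel_of X"] sets.space_closed[of "borel_of X"]
  by (simp add: average_Dirac_def sets_measure_of)

lemma emeasure_average_Dirac:
  assumes A: "A \<in> sets (borel_of X)"
  shows "emeasure (average_Dirac X xs) A =
    (\<Sum>i<length xs. emeasure (return (borel_of X) (xs ! i)) A) / of_nat (length xs)"
    (is "_ = ?m A")
proof (rule emeasure_measure_of[OF average_Dirac_def])
  show "sets (borel_of X) \<subseteq> Pow (topspace X)"
    using sets.space_closed[of "borel_of X"] by simp
  show "positive (sets (average_Dirac X xs)) ?m"
    by (simp add: positive_def)
  show "countably_additive (sets (average_Dirac X xs)) ?m"
  proof (rule countably_additiveI)
    fix F :: "nat \<Rightarrow> 'a set"
    assume F: "range F \<subseteq> sets (average_Dirac X xs)" "disjoint_family F"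
    have "(\<Sum>n. ?m (F n)) =
        (\<Sum>n. \<Sum>i<length xs. emeasure (return (borel_of X) (xs ! i)) (F n)) / of_nat (length xs)"
      by (rule ennreal_suminf_divide)
    also have "(\<Sum>n. \<Sum>i<length xs. emeasure (return (borel_of X) (xs ! i)) (F n)) =
        (\<Sum>i<length xs. \<Sum>n. emeasure (return (borel_of X) (xs ! i)) (F n))"
      by (rule suminf_sum) simp
    also have "\<dots> = (\<Sum>i<length xs. emeasure (return (borel_of X) (xs ! i)) (\<Union>n. F n))"
      using F by (intro sum.cong refl suminf_emeasure) auto
    finally show "(\<Sum>n. ?m (F n)) = ?m (\<Union>n. F n)" .
  qed
  show "A \<in> sets (average_Dirac X xs)"
    using A by simp
qed

end

theory Submission
  imports Defs
begin

text \<open>A minimal closed set of positive measure is irreducible, and the measure restricted to it is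
a multiple of the Dirac measure at its generic point \<open>x\<close>. Hence Borel sets around \<open>x\<close>, and by
invariance those around every point of the orbit of \<open>x\<close>, have measure at least some \<open>c > 0\<close>. As
distinct points are separated by Borel sets, the orbit is finite and ends in a cycle. By
ergodicity, Borel sets missing the cycle are null, and invariance makes the masses of its points
equal.\<close>

section \<open>Borel sets and the separation of points in a Zariski space\<close>

lemma closedin_borel_of:
  assumes "closedin X C" shows "C \<in> sets (borel_of X)"
proof -
  have "topspace X - C \<in> sets (borel_of X)"
    using assms by (auto simp: sets_borel_of)
  then have "space (borel_of X) - (topspace X - C) \<in> sets (borel_of X)"
    by (rule sets.compl_sets)
  moreover have "topspace X - (topspace X - C) = C"
    using closedin_subset[OF assms] by auto
  ultimately show ?thesis by simp
qed

lemma continuous_map_measurable_borel_of: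
  assumes f: "continuous_map X Y f" shows "f \<in> measurable (borel_of X) (borel_of Y)"
  unfolding borel_of_def[of Y]
proof (rule measurable_measure_of)
  show "f \<in> space (borel_of X) \<rightarrow> topspace Y"
    using continuous_map_funspace[OF f] by auto
  show "f -` U \<inter> space (borel_of X) \<in> sets (borel_of X)" if "U \<in> {U. openin Y U}" for U
  proof -
    have "openin X {x \<in> topspace X. f x \<in> U}"
      using that f by (simp add: openin_continuous_map_preimage)
    moreover have "f -` U \<inter> topspace X = {x \<in> topspace X. f x \<in> U}" by auto
    ultimately show ?thesis by (auto simp: sets_borel_of)
  qed
qed (auto dest: openin_subset)

text \<open>If the closure of \<open>x\<close> is a union of two closed sets, one of them contains
  \<open>x\<close> and hence the whole closure. For \<open>x\<close> outside the carrier the closure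
  is empty and has no proper subsets.\<close>

lemma irreducible_closedin_closure_of_singleton:
  "irreducible_closedin X (X closure_of {x})"
  unfolding irreducible_closedin_def
proof (intro conjI notI)
  assume "\<exists>A B. closedin X A \<and> closedin X B \<and> A \<subset> X closure_of {x} \<and>
    B \<subset> X closure_of {x} \<and> X closure_of {x} = A \<union> B"
  then obtain A B where AB: "closedin X A" "closedin X B" "A \<subset> X closure_of {x}"
    "B \<subset> X closure_of {x}" "X closure_of {x} = A \<union> B" by blast
  then have "x \<notin> A" "x \<notin> B"
    using closure_of_minimal[of "{x}" A X] closure_of_minimal[of "{x}" B X] by auto
  moreover have "X closure_of {x} = {}" if "x \<notin> topspace X"
    using that closure_of_restrict[of X "{x}"] by simp
  moreover have "x \<in> X closure_of {x}" if "x \<in> topspace X"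
    using that closure_of_subset[of "{x}" X] by auto
  ultimately show False using AB by auto
qed simp

text \<open>Uniqueness of generic points makes the closures of \<open>x\<close> and \<open>y\<close>
  differ, so one of the two points lies outside the closure of the other. The separating set is a
  closure or the complement of one, depending on which point it is.\<close>

lemma Zariski_space_separation:
  assumes X: "Zariski_space X" and xy: "x \<in> topspace X" "y \<in> topspace X" "x \<noteq> y"
  shows "\<exists>A\<in>sets (borel_of X). x \<in> A \<and> y \<notin> A"
proof -
  have self: "x \<in> X closure_of {x}" "y \<in> X closure_of {y}"
    using xy closure_of_subset[of "{x}" X] closure_of_subset[of "{y}" X] by auto
  have "\<exists>!z. z \<in> X closure_of {x} \<and> X closure_of {z} = X closure_of {x}"
    using X self irreducible_closedin_closure_of_singleton[of X x]
    unfolding Zariski_space_def by blast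
  then have "X closure_of {x} \<noteq> X closure_of {y}"
    using self \<open>x \<noteq> y\<close> by metis
  then consider "x \<notin> X closure_of {y}" | "y \<notin> X closure_of {x}"
    using closure_of_minimal[of "{x}" "X closure_of {y}" X]
      closure_of_minimal[of "{y}" "X closure_of {x}" X] by auto
  then show ?thesis
  proof cases
    case 1
    have "topspace X - X closure_of {y} \<in> sets (borel_of X)"
      using sets.compl_sets[OF closedin_borel_of[OF closedin_closure_of]] by simp
    then show ?thesis using 1 xy self by blast
  next
    case 2
    then show ?thesis using self closedin_borel_of[OF closedin_closure_of] by blast
  qed
qed

text \<open>Singletons need not be Borel, so the sets \<open>B i\<close> serve as measurable
  substitutes for the points \<open>z i\<close>. Countability of the index type keeps the
  intersections below measurable.\<close>

lemma Zariski_space_disjoint_separation: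
  fixes z :: "'i::countable \<Rightarrow> 'a"
  assumes X: "Zariski_space X" and z: "\<And>i. i \<in> I \<Longrightarrow> z i \<in> topspace X" "inj_on z I"
  obtains B where "\<And>i. B i \<in> sets (borel_of X)" "disjoint_family_on B I"
    "\<And>i j. i \<in> I \<Longrightarrow> j \<in> I \<Longrightarrow> z j \<in> B i \<longleftrightarrow> i = j"
proof -
  \<comment> \<open>With the conditions placed under the existential quantifier, choice yields a
    total family of Borel sets; \<open>sets.top\<close> provides the default value.\<close>
  have "\<forall>i j. \<exists>A\<in>sets (borel_of X). i \<in> I \<longrightarrow> j \<in> I \<longrightarrow> i \<noteq> j \<longrightarrow> z i \<in> A \<and> z j \<notin> A"
    using Zariski_space_separation[OF X] z by (metis inj_onD sets.top)
  then obtain A where A: "\<And>i j. A i j \<in> sets (borel_of X)"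
    "\<And>i j. i \<in> I \<Longrightarrow> j \<in> I \<Longrightarrow> i \<noteq> j \<Longrightarrow> z i \<in> A i j \<and> z j \<notin> A i j"
    by metis
  \<comment> \<open>Subtracting \<open>A j i\<close> makes the family disjoint: \<open>B i\<close>
    avoids \<open>A j i\<close>, which contains \<open>B j\<close>. The factor
    \<open>topspace X\<close> matters when \<open>I - {i}\<close> is empty, as the intersection is
    then \<open>UNIV\<close>.\<close>
  define B where "B i = topspace X \<inter> (\<Inter>j\<in>I - {i}. A i j - A j i)" for i
  have sets: "B i \<in> sets (borel_of X)" for i
  proof (cases "I - {i} = {}")
    case True
    then have "B i = space (borel_of X)" unfolding B_def True by simp
    then show ?thesis by (metis sets.top)
  next
    case False
    then show ?thesis
      unfolding B_def space_borel_of[symmetric]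
      by (intro sets.Int sets.top sets.countable_INT' sets.Diff)
        (auto intro: A(1))
  qed
  moreover have "disjoint_family_on B I"
    unfolding disjoint_family_on_def B_def by blast
  moreover have "z j \<in> B i \<longleftrightarrow> i = j" if "i \<in> I" "j \<in> I" for i j
    using that z(1) A(2) unfolding B_def by auto
  ultimately show ?thesis by (rule that)
qed

section \<open>A point charged by a Borel probability measure\<close>

text \<open>Otherwise dependent choice, started at the whole space, gives a strictly descending
  sequence of closed sets of positive measure, against the Noetherian condition.\<close>

lemma minimal_closed_set_of_positive_measure:
  assumes X: "Noetherian_space X" and M: "Borel_prob_measure X M"
  obtains E where "closedin X E" "measure M E > 0"
    "\<And>C. closedin X C \<Longrightarrow> C \<subset> E \<Longrightarrow> measure M C = 0"
proof -
  have "\<exists>E. closedin X E \<and> measure M E > 0 \<and> (\<forall>C. closedin X C \<and> C \<subset> E \<longrightarrow> measure M C = 0)"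
  proof (rule ccontr)
    assume none: "\<not> ?thesis"
    interpret prob_space M using M by (simp add: Borel_prob_measure_def)
    have "space M = topspace X"
      using M sets_eq_imp_space_eq[of M "borel_of X"] by (simp add: Borel_prob_measure_def)
    then have top: "closedin X (topspace X) \<and> measure M (topspace X) > 0"
      using prob_space by simp
    have step: "\<exists>D. (closedin X D \<and> measure M D > 0) \<and> D \<subset> C"
      if "closedin X C \<and> measure M C > 0" for C
      using none that by (metis zero_less_measure_iff)
    obtain C :: "nat \<Rightarrow> 'a set"
      where C: "\<And>n. closedin X (C n) \<and> measure M (C n) > 0" "\<And>n. C (Suc n) \<subset> C n"
      using dependent_nat_choice[where P = "\<lambda>_ C. closedin X C \<and> measure M C > 0"
          and Q = "\<lambda>_ C D. D \<subset> C"] top step by metis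
    have "decseq C" using C(2) by (auto intro!: decseq_SucI)
    then obtain N where "\<forall>n\<ge>N. C n = C N" using X C(1) unfolding Noetherian_space_def by blast
    then show False using C(2)[of N] by (metis le_SucI order_refl psubset_eq)
  qed
  then show ?thesis using that by blast
qed

text \<open>The point \<open>x\<close> is the generic point of a minimal closed set \<open>E\<close>
  of positive measure, and \<open>c\<close> is the mass of \<open>E\<close>: a Borel set containing
  \<open>x\<close> covers \<open>E\<close> up to a null set.\<close>

lemma Zariski_space_charged_point:
  assumes X: "Zariski_space X" and M: "Borel_prob_measure X M"
  obtains x c where "x \<in> topspace X" "c > 0" "\<And>A. A \<in> sets M \<Longrightarrow> x \<in> A \<Longrightarrow> c \<le> measure M A"
proof -
  interpret prob_space M using M by (simp add: Borel_prob_measure_def)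
  have sets: "sets M = sets (borel_of X)" using M by (simp add: Borel_prob_measure_def)
  have space: "space M = topspace X" using sets_eq_imp_space_eq[OF sets] by simp
  have closed: "closedin X C \<Longrightarrow> C \<in> sets M" for C
    using closedin_borel_of[of X C] sets by simp
  obtain E where E: "closedin X E" "measure M E > 0"
    and minE: "\<And>C. closedin X C \<Longrightarrow> C \<subset> E \<Longrightarrow> measure M C = 0"
    using minimal_closed_set_of_positive_measure X M unfolding Zariski_space_def by metis
  have "irreducible_closedin X E"
    unfolding irreducible_closedin_def
  proof (intro conjI notI)
    assume "\<exists>A B. closedin X A \<and> closedin X B \<and> A \<subset> E \<and> B \<subset> E \<and> E = A \<union> B"
    then obtain A B where "closedin X A" "closedin X B" "A \<subset> E" "B \<subset> E" "E = A \<union> B" by blast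
    \<comment> \<open>Both pieces are null by minimality, so their union \<open>E\<close> would be
      null.\<close>
    then show False
      using minE[of A] minE[of B] measure_Un_le[of A M B] closed E(2) by fastforce
  qed (rule E)
  moreover have "E \<noteq> {}" using E(2) by auto
  ultimately obtain x where x: "x \<in> E" "X closure_of {x} = E"
    using X unfolding Zariski_space_def by blast
  \<comment> \<open>This dichotomy is stable under complements and countable unions, so induction
    over the generated sigma-algebra reduces it to open sets.\<close>
  have "(x \<in> A \<longrightarrow> E - A \<in> null_sets M) \<and> (x \<notin> A \<longrightarrow> E \<inter> A \<in> null_sets M)"
    if "A \<in> sigma_sets (topspace X) {U. openin X U}" for A
    using that
  proof induction
    case (Basic U)
    then have U: "openin X U" by simp
    have cl: "closedin X (E - U)" using E(1) U by (rule closedin_diff)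
    \<comment> \<open>If \<open>x\<close> is in \<open>U\<close>, then \<open>E - U\<close> is a
      closed proper subset of \<open>E\<close> and minimality applies. If not, the closed complement
      of \<open>U\<close> contains \<open>x\<close>, hence its closure \<open>E\<close>.\<close>
    have "measure M (E - U) = 0" if "x \<in> U"
      using minE[OF cl] x that by blast
    moreover have "E \<inter> U = {}" if "x \<notin> U"
    proof -
      have "E \<subseteq> topspace X - U"
        using that x closedin_subset[OF E(1)] U
        by (metis Diff_iff closedin_topspace closure_of_minimal closedin_diff empty_subsetI
            insert_subset subsetD)
      then show ?thesis by blast
    qed
    ultimately show ?case
      using closed[OF cl] by (auto simp: null_sets_def emeasure_eq_measure)
  next
    case Empty
    then show ?case by simp
  next
    case (Compl A)
    moreover have "E - (topspace X - A) = E \<inter> A" "E \<inter> (topspace X - A) = E - A"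
      using closedin_subset[OF E(1)] by auto
    ultimately show ?case using x(1) closedin_subset[OF E(1)] by auto
  next
    case (Union A)
    show ?case
    proof (intro conjI impI)
      assume "x \<in> (\<Union>i. A i)"
      then obtain i where i: "x \<in> A i" by blast
      have "(\<Union>i. A i) \<in> sets M"
        using sigma_sets.Union[of A, OF Union.hyps] unfolding sets sets_borel_of .
      then show "E - (\<Union>i. A i) \<in> null_sets M"
        using Union.IH[of i] i closed[OF E(1)]
        by (auto intro!: null_sets_subset[of "E - A i" M "E - (\<Union>i. A i)"])
    next
      assume "x \<notin> (\<Union>i. A i)"
      then have "(\<Union>i. E \<inter> A i) \<in> null_sets M"
        using Union.IH by (intro null_sets_UN) auto
      then show "E \<inter> (\<Union>i. A i) \<in> null_sets M" by simp
    qed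
  qed
  then have null: "E - A \<in> null_sets M" if "A \<in> sets M" "x \<in> A" for A
    using that unfolding sets sets_borel_of by blast
  have "measure M E \<le> measure M A" if A: "A \<in> sets M" "x \<in> A" for A
  proof -
    have "measure M E \<le> measure M (A \<union> (E - A))"
      using A closed[OF E(1)] by (intro finite_measure_mono) auto
    also have "\<dots> \<le> measure M A + measure M (E - A)"
      using A closed[OF E(1)] by (intro measure_Un_le) auto
    also have "measure M (E - A) = 0"
      using null[OF A] by (simp add: null_sets_def measure_def)
    finally show ?thesis by simp
  qed
  then show ?thesis using that x(1) E closedin_subset[OF E(1)] by blast
qed

section \<open>Invariant measures charge a periodic cycle\<close>

text \<open>The measures of disjoint sets form a convergent series, so they tend to 0 and cannot
  stay above \<open>c\<close>.\<close>

lemma (in finite_measure) no_infinitely_many_charged_points: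
  fixes B :: "nat \<Rightarrow> 'a set"
  assumes "\<And>n. B n \<in> sets M" "disjoint_family B" "c > 0" "\<And>n. c \<le> measure M (B n)"
  shows False
proof -
  have "(\<lambda>n. measure M (B n)) sums measure M (\<Union>n. B n)"
    using assms by (intro finite_measure_UNION) auto
  then have "(\<lambda>n. measure M (B n)) \<longlonglongrightarrow> 0"
    by (blast intro: summable_LIMSEQ_zero sums_summable)
  then have "c \<le> 0"
    by (rule LIMSEQ_le_const) (use assms in auto)
  with assms show False by simp
qed

lemma invariant_measure_vimage:
  assumes "invariant_measure f M" "A \<in> sets M"
  shows "f -` A \<inter> space M \<in> sets M" "measure M (f -` A \<inter> space M) = measure M A"
proof -
  show "f -` A \<inter> space M \<in> sets M"
    using assms unfolding invariant_measure_def by (blast intro: measurable_sets)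
  show "measure M (f -` A \<inter> space M) = measure M A"
    using assms measure_distr[of f M M A] unfolding invariant_measure_def by simp
qed

text \<open>From two times \<open>m < n\<close> at which the orbit agrees, the point reached at time
  \<open>m\<close> is periodic; \<open>r\<close> is its least period, which makes the first
  \<open>r\<close> iterates distinct.\<close>

lemma obtain_cycle_of_eventually_periodic:
  assumes "\<not> inj (\<lambda>n. (f ^^ n) x)"
  obtains m r where "r > 0" "(f ^^ r) ((f ^^ m) x) = (f ^^ m) x"
    "inj_on (\<lambda>i. (f ^^ i) ((f ^^ m) x)) {..<r}"
proof -
  obtain m n where mn: "m < n" "(f ^^ m) x = (f ^^ n) x"
    using assms unfolding inj_def by (metis linorder_neqE_nat)
  define z where "z = (f ^^ m) x"
  define r where "r = (LEAST p. 0 < p \<and> (f ^^ p) z = z)"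
  have "(f ^^ (n - m)) z = (f ^^ (n - m + m)) x"
    by (simp add: z_def funpow_add)
  then have "0 < n - m \<and> (f ^^ (n - m)) z = z"
    using mn by (simp add: z_def)
  then have r: "0 < r \<and> (f ^^ r) z = z"
    unfolding r_def by (rule LeastI)
  have least: "(f ^^ p) z \<noteq> z" if "0 < p" "p < r" for p
    using that not_less_Least unfolding r_def by blast
  have neq: "(f ^^ i) z \<noteq> (f ^^ j) z" if ij: "i < j" "j < r" for i j
  proof
    assume "(f ^^ i) z = (f ^^ j) z"
    \<comment> \<open>Another \<open>r - j\<close> steps take the right side to
      \<open>(f ^^ r) z = z\<close>, so \<open>z\<close> would already return at time
      \<open>r - j + i\<close>, before \<open>r\<close>.\<close>
    then have "(f ^^ (r - j)) ((f ^^ i) z) = (f ^^ (r - j)) ((f ^^ j) z)" by simp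
    then have "(f ^^ (r - j + i)) z = (f ^^ (r - j + j)) z"
      unfolding funpow_add o_apply .
    moreover have "r - j + j = r" "0 < r - j + i" "r - j + i < r" using ij by auto
    ultimately show False using least[of "r - j + i"] r by simp
  qed
  have "inj_on (\<lambda>i. (f ^^ i) z) {..<r}"
    by (intro inj_onI) (metis neq lessThan_iff linorder_neqE_nat)
  then show ?thesis using that r unfolding z_def by blast
qed

text \<open>The lower bound \<open>c\<close> at the charged point passes to its whole orbit, which
  must then be finite. Only the bound at \<open>hd xs\<close> is recorded, as this is what the
  ergodicity argument consumes.\<close>

lemma invariant_measure_charges_periodic_cycle:
  assumes X: "Zariski_space X" and f: "f \<in> topspace X \<rightarrow> topspace X"
    and M: "Borel_prob_measure X M" "invariant_measure f M"
  obtains xs c where "periodic_cycle X f xs" "c > 0"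
    "\<And>A. A \<in> sets M \<Longrightarrow> hd xs \<in> A \<Longrightarrow> c \<le> measure M A"
proof -
  interpret prob_space M using M by (simp add: Borel_prob_measure_def)
  have sets: "sets M = sets (borel_of X)" using M by (simp add: Borel_prob_measure_def)
  have space: "space M = topspace X" using sets_eq_imp_space_eq[OF sets] by simp
  obtain x c where x: "x \<in> topspace X" and c: "c > 0"
    and le: "\<And>A. A \<in> sets M \<Longrightarrow> x \<in> A \<Longrightarrow> c \<le> measure M A"
    using Zariski_space_charged_point[OF X M(1)] by blast
  have orbit: "(f ^^ n) x \<in> topspace X" for n
    using x f by (induction n) auto
  have charged: "c \<le> measure M A" if "A \<in> sets M" "(f ^^ n) x \<in> A" for n A
    using that
  proof (induction n arbitrary: A)
    case 0
    then show ?case using le by simp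
  next
    case (Suc n)
    \<comment> \<open>A Borel set around the next orbit point pulls back to one around the current
      point, and invariance preserves its measure.\<close>
    have "c \<le> measure M (f -` A \<inter> space M)"
      using Suc.prems orbit[of n] space
      by (intro Suc.IH invariant_measure_vimage[OF M(2)]) auto
    then show ?case using invariant_measure_vimage(2)[OF M(2) Suc.prems(1)] by simp
  qed
  have "\<not> inj (\<lambda>n. (f ^^ n) x)"
  proof
    assume "inj (\<lambda>n. (f ^^ n) x)"
    then obtain B where B: "\<And>n. B n \<in> sets (borel_of X)" "disjoint_family B"
      "\<And>i j. (f ^^ j) x \<in> B i \<longleftrightarrow> i = j"
      using Zariski_space_disjoint_separation[OF X, of UNIV "\<lambda>n. (f ^^ n) x"] orbit
      by (metis UNIV_I)
    show False
      by (rule no_infinitely_many_charged_points[of B c]) (use B c charged sets in auto)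
  qed
  then obtain m r where r: "r > 0" "(f ^^ r) ((f ^^ m) x) = (f ^^ m) x"
    and inj: "inj_on (\<lambda>i. (f ^^ i) ((f ^^ m) x)) {..<r}"
    by (rule obtain_cycle_of_eventually_periodic)
  define xs where "xs = map (\<lambda>i. (f ^^ i) ((f ^^ m) x)) [0..<r]"
  have "hd xs = (f ^^ m) x" unfolding xs_def using r(1) by (simp add: hd_map)
  moreover have "periodic_cycle X f xs"
    unfolding periodic_cycle_def
  proof (intro conjI allI impI)
    show "xs \<noteq> []" using r(1) by (simp add: xs_def)
    show "distinct xs"
      using inj by (simp add: xs_def distinct_map atLeast0LessThan)
    have "(f ^^ i) ((f ^^ m) x) \<in> topspace X" for i
      using orbit[of "i + m"] by (simp add: funpow_add)
    then show "set xs \<subseteq> topspace X" by (auto simp: xs_def)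
    fix i assume "i < length xs"
    then have "i < r" by (simp add: xs_def)
    \<comment> \<open>At the last index the successor wraps round to 0, in accordance with the
      period \<open>r\<close>.\<close>
    then consider "Suc i < r" | "Suc i = r" by linarith
    then show "f (xs ! i) = xs ! (Suc i mod length xs)"
      by cases (use r in \<open>auto simp: xs_def\<close>)
  qed
  ultimately show ?thesis using that c charged by metis
qed

section \<open>Averages over periodic cycles are ergodic\<close>

text \<open>From \<open>i\<close>, exactly \<open>r - i + j\<close> cyclic steps lead to
  \<open>(r + j) mod r = j\<close>. This spreads a property from one point of a cycle to all of
  them.\<close>

lemma Suc_mod_induct:
  fixes r :: nat
  assumes "i < r" "j < r" "P i" "\<And>i. i < r \<Longrightarrow> P i \<Longrightarrow> P (Suc i mod r)"
  shows "P j"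
proof -
  have "P ((i + k) mod r)" for k
  proof (induction k)
    case (Suc k)
    then have "P (Suc ((i + k) mod r) mod r)" using assms by (intro assms) auto
    then show ?case by (simp add: mod_Suc_eq)
  qed (use assms in simp)
  from this[of "r - i + j"] show ?thesis using assms by simp
qed

text \<open>This is the permutation of indices that \<open>f\<close> induces on a cycle; an
  injective self-map of a finite set is onto.\<close>

lemma bij_betw_Suc_mod: "bij_betw (\<lambda>i. Suc i mod r) {..<r} {..<r}"
proof -
  have "inj_on (\<lambda>i. Suc i mod r) {..<r}"
    by (auto simp: inj_on_def mod_Suc split: if_splits)
  moreover have "(\<lambda>i. Suc i mod r) ` {..<r} \<subseteq> {..<r}" by auto
  ultimately show ?thesis
    by (simp add: bij_betw_def endo_inj_surj)
qed

lemma emeasure_average_Dirac_real: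
  assumes "A \<in> sets (borel_of X)" "xs \<noteq> []"
  shows "emeasure (average_Dirac X xs) A =
    ennreal ((\<Sum>i<length xs. indicator A (xs ! i)) / length xs)"
proof -
  have "emeasure (average_Dirac X xs) A =
      (\<Sum>i<length xs. ennreal (indicator A (xs ! i))) / of_nat (length xs)"
    using assms by (simp add: emeasure_average_Dirac ennreal_indicator)
  also have "\<dots> = ennreal (\<Sum>i<length xs. indicator A (xs ! i)) / ennreal (length xs)"
    by (subst sum_ennreal) (auto simp: ennreal_of_nat_eq_real_of_nat)
  also have "\<dots> = ennreal ((\<Sum>i<length xs. indicator A (xs ! i)) / length xs)"
    using assms by (intro divide_ennreal) (auto intro: sum_nonneg)
  finally show ?thesis .
qed

text \<open>The average counts the cycle points in a set. Passing to the preimage under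
  \<open>f\<close> shifts the summation index cyclically, which gives invariance. A strictly
  invariant set containing one point of the cycle contains all of them, so its measure is 0 or
  1.\<close>

lemma ergodic_average_Dirac:
  assumes f: "continuous_map X X f" and xs: "periodic_cycle X f xs"
  shows "ergodic_Borel_prob_measure X f (average_Dirac X xs)" (is "ergodic_Borel_prob_measure X f ?M")
proof -
  let ?r = "length xs"
  have ne: "xs \<noteq> []" and top: "\<And>i. i < ?r \<Longrightarrow> xs ! i \<in> topspace X"
    and cyc: "\<And>i. i < ?r \<Longrightarrow> f (xs ! i) = xs ! (Suc i mod ?r)"
    using xs by (auto simp: periodic_cycle_def)
  have space: "space ?M = topspace X"
    using sets_eq_imp_space_eq[OF sets_average_Dirac] by simp
  have meas: "f \<in> measurable ?M ?M"
    using continuous_map_measurable_borel_of[OF f] by (simp cong: measurable_cong_sets)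
  have "emeasure ?M (space ?M) = 1"
    using ne top by (simp add: emeasure_average_Dirac_real space space_borel_of[symmetric] del: space_borel_of)
  then interpret prob_space ?M by (rule prob_spaceI)
  have inv: "distr ?M ?M f = ?M"
  proof (rule measure_eqI)
    fix A assume "A \<in> sets (distr ?M ?M f)"
    then have A: "A \<in> sets ?M" by simp
    have pre: "f -` A \<inter> topspace X \<in> sets ?M" using measurable_sets[OF meas A] space by simp
    have "(\<Sum>i<?r. indicator (f -` A \<inter> topspace X) (xs ! i) :: real) =
        (\<Sum>i<?r. indicator A (xs ! (Suc i mod ?r)))"
      using top cyc by (intro sum.cong) (auto simp: indicator_def)
    also have "\<dots> = (\<Sum>i<?r. indicator A (xs ! i))"
      by (rule sum.reindex_bij_betw[OF bij_betw_Suc_mod])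
    finally show "emeasure (distr ?M ?M f) A = emeasure ?M A"
      using A pre ne by (simp add: emeasure_distr[OF meas] space emeasure_average_Dirac_real)
  qed simp
  have "measure ?M A = 0 \<or> measure ?M A = 1" if A: "A \<in> sets ?M" "f -` A \<inter> space ?M = A" for A
  proof (cases "\<exists>i<?r. xs ! i \<in> A")
    case True
    then have "xs ! j \<in> A" if "j < ?r" for j
      using Suc_mod_induct[of _ ?r j "\<lambda>i. xs ! i \<in> A"] that A(2) cyc by (metis IntD1 vimageD)
    then show ?thesis using A ne by (simp add: measure_def emeasure_average_Dirac_real)
  next
    case False
    then show ?thesis using A ne by (simp add: measure_def emeasure_average_Dirac_real)
  qed
  then show ?thesis
    using inv meas prob_space_axioms
    by (simp add: ergodic_Borel_prob_measure_def Borel_prob_measure_def invariant_measure_def)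
qed

section \<open>Ergodic measures are averages over periodic cycles\<close>

text \<open>The set \<open>T\<close> of points whose orbit enters \<open>S\<close> satisfies \<open>f\<^sup>-\<^sup>1 T \<subseteq> T\<close>; the preimages of \<open>T\<close> all
have the same measure and decrease to a strictly invariant set.\<close>

lemma ergodic_null_set_of_invariant_complement:
  assumes M: "ergodic_Borel_prob_measure X f M" and S: "S \<in> sets M"
    and z: "\<And>n. (f ^^ n) z \<in> space M - S"
    and c: "c > 0" "\<And>A. A \<in> sets M \<Longrightarrow> z \<in> A \<Longrightarrow> c \<le> measure M A"
  shows "measure M S = 0"
proof -
  interpret prob_space M
    using M by (simp add: ergodic_Borel_prob_measure_def Borel_prob_measure_def)
  have inv: "invariant_measure f M"
    and erg: "\<And>A. A \<in> sets M \<Longrightarrow> f -` A \<inter> space M = A \<Longrightarrow> measure M A = 0 \<or> measure M A = 1"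
    using M by (auto simp: ergodic_Borel_prob_measure_def)
  have f: "x \<in> space M \<Longrightarrow> f x \<in> space M" for x
    using inv unfolding invariant_measure_def by (blast dest: measurable_space)
  define T where "T n = {x \<in> space M. \<exists>k\<ge>n. (f ^^ k) x \<in> S}" for n
  have pre: "f -` T n \<inter> space M = T (Suc n)" for n
  proof -
    have "(\<exists>k\<ge>n. (f ^^ k) (f x) \<in> S) \<longleftrightarrow> (\<exists>k\<ge>Suc n. (f ^^ k) x \<in> S)" for x
      by (metis Suc_le_D Suc_le_mono comp_apply funpow_Suc_right)
    then show ?thesis using f by (auto simp: T_def)
  qed
  have S_pre: "{x \<in> space M. (f ^^ k) x \<in> S} \<in> sets M" for k
  proof -
    have "f ^^ k \<in> measurable M M"
      using inv unfolding invariant_measure_def by (induction k) (auto intro: measurable_comp)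
    from measurable_sets[OF this S] show ?thesis by (simp add: vimage_def Int_def conj_commute)
  qed
  have T0: "T 0 \<in> sets M"
  proof -
    have "T 0 = (\<Union>k. {x \<in> space M. (f ^^ k) x \<in> S})" by (auto simp: T_def)
    then show ?thesis using S_pre by auto
  qed
  have T: "T n \<in> sets M \<and> measure M (T n) = measure M (T 0)" for n
  proof (induction n)
    case (Suc n)
    then show ?case using invariant_measure_vimage[OF inv, of "T n"] by (simp add: pre)
  qed (simp add: T0)
  define T' where "T' = (\<Inter>n. T n)"
  have T': "T' \<in> sets M" unfolding T'_def using T by auto
  have "decseq T" unfolding T_def by (intro decseq_SucI) (auto intro: Suc_leD)
  then have "(\<lambda>n. measure M (T n)) \<longlonglongrightarrow> measure M T'"
    unfolding T'_def using T by (intro finite_Lim_measure_decseq) auto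
  then have eq: "measure M T' = measure M (T 0)"
    using T LIMSEQ_unique by (metis (no_types, lifting) LIMSEQ_const_iff ext)
  have "f -` T' \<inter> space M = (\<Inter>n. T (Suc n))"
    unfolding T'_def pre[symmetric] by auto
  also have "\<dots> = T'"
    using \<open>decseq T\<close> unfolding T'_def by (auto simp: decseq_Suc_iff)
  finally have "measure M T' = 0 \<or> measure M T' = 1" using erg T' by blast
  \<comment> \<open>The orbit of \<open>z\<close> avoids \<open>S\<close>, so \<open>z\<close> lies
    outside \<open>T'\<close>. The complement of \<open>T'\<close> thus has mass at least
    \<open>c\<close>, which excludes measure 1 for \<open>T'\<close>.\<close>
  moreover have "z \<in> space M - T'"
    using z z[of 0] unfolding T'_def T_def by auto
  then have "c \<le> measure M (space M - T')" using c(2) T' by blast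
  ultimately have "measure M T' = 0" using prob_compl[OF T'] c(1) by auto
  moreover have "S \<subseteq> T 0"
    using sets.sets_into_space[OF S] unfolding T_def by (force intro: exI[of _ 0])
  then have "measure M S \<le> measure M (T 0)" using T0 by (intro finite_measure_mono)
  ultimately show ?thesis using eq by (simp add: measure_le_0_iff)
qed

text \<open>The measure of a Borel set depends only on which cycle points it contains, so it is a
  sum of weights, the weight of \<open>xs ! i\<close> being the mass of its substitute
  \<open>B i\<close>. Invariance makes the weights equal and total mass 1 fixes their value.\<close>

lemma (in prob_space) supported_on_cycle_imp_average_Dirac:
  assumes X: "Zariski_space X" and sets: "sets M = sets (borel_of X)"
    and inv: "invariant_measure f M" and xs: "periodic_cycle X f xs"
    and null: "\<And>S. S \<in> sets M \<Longrightarrow> S \<inter> set xs = {} \<Longrightarrow> measure M S = 0"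
  shows "M = average_Dirac X xs"
proof -
  let ?r = "length xs"
  have ne: "xs \<noteq> []" and dist: "distinct xs" and top: "\<And>i. i < ?r \<Longrightarrow> xs ! i \<in> topspace X"
    and cyc: "\<And>i. i < ?r \<Longrightarrow> f (xs ! i) = xs ! (Suc i mod ?r)"
    using xs by (auto simp: periodic_cycle_def)
  have space: "space M = topspace X" using sets_eq_imp_space_eq[OF sets] by simp
  obtain B where B: "\<And>i. B i \<in> sets M" "disjoint_family_on B {..<?r}"
    and xB: "\<And>i j. i < ?r \<Longrightarrow> j < ?r \<Longrightarrow> xs ! j \<in> B i \<longleftrightarrow> i = j"
  proof (rule Zariski_space_disjoint_separation[OF X, of "{..<?r}" "\<lambda>i. xs ! i"])
    show "inj_on (\<lambda>i. xs ! i) {..<?r}" using dist by (simp add: inj_on_nth)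
  qed (use top sets in auto)
  \<comment> \<open>The two differences miss the cycle, so both are null.\<close>
  have eq_measure: "measure M A = measure M C"
    if "A \<in> sets M" "C \<in> sets M" "\<And>i. i < ?r \<Longrightarrow> xs ! i \<in> A \<longleftrightarrow> xs ! i \<in> C" for A C
  proof -
    have "measure M (A - C) = 0" "measure M (C - A) = 0"
      using that by (auto intro!: null simp: in_set_conv_nth)
    then show ?thesis
      using that finite_measure_Diff'[of A C] finite_measure_Diff'[of C A] by (simp add: Int_commute)
  qed
  have split: "measure M A = (\<Sum>i<?r. indicator A (xs ! i) * measure M (B i))" if A: "A \<in> sets M" for A
  proof -
    \<comment> \<open>The sets \<open>B i\<close> need not cover \<open>A\<close>, but the union
      contains the same cycle points as \<open>A\<close>.\<close>
    have "measure M A = measure M (\<Union>i<?r. A \<inter> B i)"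
      using A B xB by (intro eq_measure) auto
    also have "\<dots> = (\<Sum>i<?r. measure M (A \<inter> B i))"
      using A B by (intro finite_measure_finite_Union) (auto simp: disjoint_family_on_def)
    also have "\<dots> = (\<Sum>i<?r. indicator A (xs ! i) * measure M (B i))"
    proof (rule sum.cong[OF refl])
      fix i assume i: "i \<in> {..<?r}"
      show "measure M (A \<inter> B i) = indicator A (xs ! i) * measure M (B i)"
      proof (cases "xs ! i \<in> A")
        case True
        then have "measure M (A \<inter> B i) = measure M (B i)"
          using i A B xB by (intro eq_measure) auto
        then show ?thesis using True by simp
      next
        case False
        then have "measure M (A \<inter> B i) = measure M {}"
          using i A B xB by (intro eq_measure) auto
        then show ?thesis using False by simp
      qed
    qed
    finally show ?thesis .
  qed
  have Suc: "measure M (B (Suc i mod ?r)) = measure M (B i)" if i: "i < ?r" for i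
  proof -
    \<comment> \<open>As the shift of indices is injective, the only cycle point in this preimage is
      \<open>xs ! i\<close>, just as for \<open>B i\<close>.\<close>
    have "measure M (f -` B (Suc i mod ?r) \<inter> space M) = measure M (B i)"
    proof (intro eq_measure invariant_measure_vimage(1)[OF inv] B)
      fix j assume j: "j < ?r"
      have "Suc i mod ?r = Suc j mod ?r \<longleftrightarrow> i = j"
        using bij_betw_imp_inj_on[OF bij_betw_Suc_mod[of ?r]] i j by (auto dest: inj_onD)
      moreover have "Suc i mod ?r < ?r" "Suc j mod ?r < ?r" using ne by auto
      ultimately show "xs ! j \<in> f -` B (Suc i mod ?r) \<inter> space M \<longleftrightarrow> xs ! j \<in> B i"
        using i j top cyc space xB by auto
    qed
    then show ?thesis using invariant_measure_vimage(2)[OF inv B(1)] by simp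
  qed
  have const: "measure M (B i) = measure M (B 0)" if "i < ?r" for i
    using that ne by (intro Suc_mod_induct[of 0 ?r i "\<lambda>i. measure M (B i) = measure M (B 0)"])
      (auto simp: Suc)
  have split0: "measure M A = (\<Sum>i<?r. indicator A (xs ! i)) * measure M (B 0)"
    if "A \<in> sets M" for A
    unfolding split[OF that] sum_distrib_right using const by (intro sum.cong) auto
  have "measure M (B 0) = 1 / ?r"
    using split0[OF sets.top] prob_space top ne by (simp add: space field_simps)
  then show ?thesis
    using split0 sets ne
    by (intro measure_eqI) (auto simp: emeasure_average_Dirac_real emeasure_eq_measure)
qed

lemma ergodic_imp_average_Dirac:
  assumes X: "Zariski_space X" and M: "ergodic_Borel_prob_measure X f M"
    and f: "f \<in> topspace X \<rightarrow> topspace X"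
  shows "\<exists>xs. periodic_cycle X f xs \<and> M = average_Dirac X xs"
proof -
  have B: "Borel_prob_measure X M" and inv: "invariant_measure f M"
    using M by (auto simp: ergodic_Borel_prob_measure_def)
  then interpret prob_space M by (simp add: Borel_prob_measure_def)
  have sets: "sets M = sets (borel_of X)" using B by (simp add: Borel_prob_measure_def)
  have space: "space M = topspace X" using sets_eq_imp_space_eq[OF sets] by simp
  obtain xs c where xs: "periodic_cycle X f xs"
    and c: "c > 0" "\<And>A. A \<in> sets M \<Longrightarrow> hd xs \<in> A \<Longrightarrow> c \<le> measure M A"
    using invariant_measure_charges_periodic_cycle[OF X f B inv] by blast
  have orbit: "(f ^^ n) (hd xs) \<in> set xs" for n
  proof (induction n)
    case 0
    then show ?case using xs by (simp add: periodic_cycle_def)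
  next
    case (Suc n)
    then obtain i where i: "i < length xs" "(f ^^ n) (hd xs) = xs ! i"
      by (auto simp: in_set_conv_nth)
    then have "f (xs ! i) = xs ! (Suc i mod length xs)" "Suc i mod length xs < length xs"
      using xs by (auto simp: periodic_cycle_def)
    then show ?case using i by (simp add: nth_mem)
  qed
  \<comment> \<open>The orbit of \<open>hd xs\<close> stays in the cycle and so never enters
    \<open>S\<close>, while \<open>hd xs\<close> itself is charged.\<close>
  have "measure M S = 0" if "S \<in> sets M" "S \<inter> set xs = {}" for S
    using that orbit xs space c
    by (intro ergodic_null_set_of_invariant_complement[OF M, where z = "hd xs"])
      (auto simp: periodic_cycle_def)
  then show ?thesis
    using supported_on_cycle_imp_average_Dirac[OF X sets inv xs] xs by blast
qed

theorem theoremD: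
  fixes X :: "'a topology" and f :: "'a \<Rightarrow> 'a"
  assumes "Zariski_space X"
    and "continuous_map X X f"
  shows "{M. ergodic_Borel_prob_measure X f M} = {average_Dirac X xs | xs. periodic_cycle X f xs}"
  using ergodic_imp_average_Dirac[OF assms(1) _ continuous_map_funspace[OF assms(2)]]
    ergodic_average_Dirac[OF assms(2)]
  by blast

end
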